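(* Fix a fitted screening pipeline and an audit size $N_0\ge 1$ before observing audit outcomes. Apply the pipeline to $N_0$ independent and identically distributed human audit documents, independent of the fitting data; if scoring is randomized, use independent per-document randomization from a common fixed law. Then, conditional on the fitted pipeline, the number of false alerts satisfies $K\sim\operatorname{Binomial}(N_0,q)$, where $q$ is the deployment false-alert probability of the pipeline. If $K=0$, the one-sided Clopper--Pearson upper confidence limit for $q$ at confidence level $1-\gamma$, $0<\gamma<1$, is $$U_{1-\gamma}=1-\gamma^{1/N_0}.$$ At $\gamma=0.05$, the condition $U_{0.95}<0.001$ requires $N_0\ge 2995$.
   Context: A fitted pipeline is a fixed measurable rule that maps a document (and its own random seed, if scoring is randomized) to alert or no alert; $q$ is the probability that it alerts on a human document drawn from the audit/deployment human law (with a fresh seed). The one-sided Clopper--Pearson upper confidence limit at level $1-\gamma$ after observing $K=k$ is obtained by inverting the lower binomial tail, i.e. it is $\sup\{q\in[0,1]:\ \mathbb P_{q}(\operatorname{Binomial}(N_0,q)\le k)\ge\gamma\}$; for $k=0$ it is the solution $U\in[0,1]$ of $\mathbb P_{q=U}(K=0)=\gamma$. *)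

theory Defs
  imports "HOL-Probability.Probability"
begin

(* A pipeline p is an element of a measurable space of rules; it sends a document x and the random
   seed s used to score it to the decision "alert p x s".  Deterministic scoring is the case in
   which alert ignores s. *)

text \<open>Probability that pipeline \<open>p\<close> alerts on a fresh human document, of law \<open>H\<close>, scored with a
  fresh independent seed, of law \<open>R\<close>.\<close>

definition false_alert_prob ::
    "('p \<Rightarrow> 'x \<Rightarrow> 's \<Rightarrow> bool) \<Rightarrow> 'x measure \<Rightarrow> 's measure \<Rightarrow> 'p \<Rightarrow> real" where
  "false_alert_prob alert H R p =
     measure (H \<Otimes>\<^sub>M R) {(x, s). x \<in> space H \<and> s \<in> space R \<and> alert p x s}"

definition false_alert_count ::
    "('p \<Rightarrow> 'x \<Rightarrow> 's \<Rightarrow> bool) \<Rightarrow> nat \<Rightarrow> ('w \<Rightarrow> 'p) \<Rightarrow> (nat \<Rightarrow> 'w \<Rightarrow> 'x) \<Rightarrow> (nat \<Rightarrow> 'w \<Rightarrow> 's) \<Rightarrow> 'w \<Rightarrow> nat" where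
  "false_alert_count alert N F X S w = card {i. i < N \<and> alert (F w) (X i w) (S i w)}"

text \<open>Independence of two random elements of possibly different types; the library's \<open>indep_var\<close>
  requires both to take values in the same type. The two families of preimages are the generated
  sigma-algebras.\<close>

definition indep_elements ::
    "'w measure \<Rightarrow> 'a measure \<Rightarrow> ('w \<Rightarrow> 'a) \<Rightarrow> 'b measure \<Rightarrow> ('w \<Rightarrow> 'b) \<Rightarrow> bool" where
  "indep_elements M A Y B V \<longleftrightarrow>
     Y \<in> measurable M A \<and> V \<in> measurable M B \<and>
     prob_space.indep_set M {Y -` E \<inter> space M | E. E \<in> sets A} {V -` E \<inter> space M | E. E \<in> sets B}"

text \<open>Conditional probability of the event \<open>A\<close> given the sigma-algebra generated by the random
  element \<open>Y\<close> of \<open>P\<close>; as a conditional expectation it is determined only almost everywhere.\<close>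

definition cond_prob_given ::
    "'w measure \<Rightarrow> 'p measure \<Rightarrow> ('w \<Rightarrow> 'p) \<Rightarrow> 'w set \<Rightarrow> 'w \<Rightarrow> real" where
  "cond_prob_given M P Y A = real_cond_exp M (vimage_algebra (space M) Y P) (indicator A)"

text \<open>One-sided Clopper--Pearson upper confidence limit at level \<open>1 - \<gamma>\<close> after \<open>k\<close> events have been
  observed in \<open>N\<close> trials.\<close>

definition clopper_pearson_upper :: "nat \<Rightarrow> nat \<Rightarrow> real \<Rightarrow> real" where
  "clopper_pearson_upper N k \<gamma> =
     Sup {q. 0 \<le> q \<and> q \<le> 1 \<and> measure_pmf.prob (binomial_pmf N q) {..k} \<ge> \<gamma>}"

end

theory Submission
  imports Defs
begin

text \<open>By the two independence assumptions the joint law of fitting data, documents and seeds is a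
  product measure. For a fixed pipeline, Tonelli turns the probability of each pattern of alerts
  into a product of single-document probabilities, and summing over the patterns with \<open>k\<close> alerts
  gives the binomial mass; integrating this over the pipelines in a measurable set is exactly the
  defining property of the conditional probability. For the audit size,
  \<open>1 - 0.05 powr (1 / N) < 0.001\<close> means \<open>0.999 ^ N < 0.05\<close>, which fails at \<open>N = 2994\<close>.\<close>

section \<open>Alert patterns and alert counts for a fixed pipeline\<close>

text \<open>Once the documents are frozen, prescribing the alert set constrains each seed
  separately, so the event is a box and its measure is a product of factors
  \<open>f i (x i)\<close>. Each factor depends on one document only, so integrating over
  independent documents again gives a product, with factor \<open>q\<close> for
  \<open>i \<in> J\<close> and \<open>1 - q\<close> otherwise.\<close>

lemma nn_integral_PiM_pattern:
  fixes a :: "'x \<Rightarrow> 's \<Rightarrow> bool" and I :: "'i set"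
  assumes H: "prob_space H" and R: "prob_space R" and I: "finite I"
    and a[measurable]: "Measurable.pred (H \<Otimes>\<^sub>M R) (\<lambda>(x, s). a x s)"
  defines "q \<equiv> measure (H \<Otimes>\<^sub>M R) {(x, s). x \<in> space H \<and> s \<in> space R \<and> a x s}"
  shows "(\<integral>\<^sup>+ x. emeasure (PiM I (\<lambda>_. R))
            {s \<in> space (PiM I (\<lambda>_. R)). \<forall>i\<in>I. a (x i) (s i) \<longleftrightarrow> i \<in> J} \<partial>PiM I (\<lambda>_. H))
         = ennreal (q ^ card (I \<inter> J) * (1 - q) ^ card (I - J))"
proof -
  interpret H: prob_space H by fact
  interpret R: prob_space R by fact
  interpret HR: pair_prob_space H R by unfold_locales
  interpret PH: product_sigma_finite "\<lambda>_::'i. H"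
    by (simp add: product_sigma_finite_def H.sigma_finite_measure_axioms)
  interpret PR: product_sigma_finite "\<lambda>_::'i. R"
    by (simp add: product_sigma_finite_def R.sigma_finite_measure_axioms)
  have q: "0 \<le> q" "q \<le> 1" by (auto simp: q_def)
  have q_eq: "{(x, s). x \<in> space H \<and> s \<in> space R \<and> a x s}
      = {y \<in> space (H \<Otimes>\<^sub>M R). case y of (x, s) \<Rightarrow> a x s}"
    by (auto simp: space_pair_measure)
  define f where "f i x = emeasure R {s \<in> space R. a x s \<longleftrightarrow> i \<in> J}" for i x
  have f_meas: "f i \<in> borel_measurable H" for i
    unfolding f_def by measurable
  have f_int: "integral\<^sup>N H (f i) = ennreal (if i \<in> J then q else 1 - q)" for i
  proof -
    let ?Q = "{y \<in> space (H \<Otimes>\<^sub>M R). (case y of (x, s) \<Rightarrow> a x s) \<longleftrightarrow> i \<in> J}"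
    have "emeasure (H \<Otimes>\<^sub>M R) ?Q = (\<integral>\<^sup>+ x. emeasure R (Pair x -` ?Q) \<partial>H)"
      by (rule R.emeasure_pair_measure_alt) measurable
    also have "\<dots> = integral\<^sup>N H (f i)"
      unfolding f_def
      by (intro nn_integral_cong arg_cong2[where f = emeasure]) (auto simp: space_pair_measure)
    finally have "integral\<^sup>N H (f i) = emeasure (H \<Otimes>\<^sub>M R) ?Q" ..
    also have "\<dots> = ennreal (measure (H \<Otimes>\<^sub>M R) ?Q)"
      by (rule HR.P.emeasure_eq_measure)
    also have "measure (H \<Otimes>\<^sub>M R) ?Q = (if i \<in> J then q else 1 - q)"
      unfolding q_def q_eq by (auto intro!: HR.P.prob_neg)
    finally show ?thesis .
  qed
  have "(\<integral>\<^sup>+ x. emeasure (PiM I (\<lambda>_. R))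
            {s \<in> space (PiM I (\<lambda>_. R)). \<forall>i\<in>I. a (x i) (s i) \<longleftrightarrow> i \<in> J} \<partial>PiM I (\<lambda>_. H))
      = (\<integral>\<^sup>+ x. (\<Prod>i\<in>I. f i (x i)) \<partial>PiM I (\<lambda>_. H))"
  proof (rule nn_integral_cong)
    fix x assume x: "x \<in> space (PiM I (\<lambda>_. H))"
    have "{s \<in> space (PiM I (\<lambda>_. R)). \<forall>i\<in>I. a (x i) (s i) \<longleftrightarrow> i \<in> J}
        = Pi\<^sub>E I (\<lambda>i. {s \<in> space R. a (x i) s \<longleftrightarrow> i \<in> J})"
      by (auto simp: space_PiM PiE_iff extensional_def)
    moreover have "{s \<in> space R. a (x i) s \<longleftrightarrow> i \<in> J} \<in> sets R" if "i \<in> I" for i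
    proof -
      have [measurable]: "x i \<in> space H" using x that by (auto simp: space_PiM)
      show ?thesis by measurable
    qed
    ultimately show "emeasure (PiM I (\<lambda>_. R))
        {s \<in> space (PiM I (\<lambda>_. R)). \<forall>i\<in>I. a (x i) (s i) \<longleftrightarrow> i \<in> J} = (\<Prod>i\<in>I. f i (x i))"
      using I by (simp add: PR.emeasure_PiM f_def)
  qed
  also have "\<dots> = (\<Prod>i\<in>I. integral\<^sup>N H (f i))"
    by (rule PH.product_nn_integral_prod) (use I f_meas in auto)
  also have "\<dots> = ennreal (\<Prod>i\<in>I. if i \<in> J then q else 1 - q)"
    unfolding f_int using q by (intro prod_ennreal) auto
  also have "(\<Prod>i\<in>I. if i \<in> J then q else 1 - q) = q ^ card (I \<inter> J) * (1 - q) ^ card (I - J)"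
    using I by (simp add: prod.If_cases Diff_eq)
  finally show ?thesis .
qed

text \<open>The event splits disjointly according to the exact set \<open>J\<close> of alerting
  indices. All \<open>J\<close> of size \<open>k\<close> have the same mass by the pattern lemma,
  and the number of such \<open>J\<close> supplies the binomial coefficient.\<close>

lemma nn_integral_PiM_count:
  fixes a :: "'x \<Rightarrow> 's \<Rightarrow> bool" and I :: "'i set"
  assumes H: "prob_space H" and R: "prob_space R" and I: "finite I"
    and a[measurable]: "Measurable.pred (H \<Otimes>\<^sub>M R) (\<lambda>(x, s). a x s)"
  defines "q \<equiv> measure (H \<Otimes>\<^sub>M R) {(x, s). x \<in> space H \<and> s \<in> space R \<and> a x s}"
  shows "(\<integral>\<^sup>+ x. emeasure (PiM I (\<lambda>_. R))
            {s \<in> space (PiM I (\<lambda>_. R)). card {i\<in>I. a (x i) (s i)} = k} \<partial>PiM I (\<lambda>_. H))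
         = ennreal (pmf (binomial_pmf (card I) q) k)"
proof -
  interpret H: prob_space H by fact
  interpret R: prob_space R by fact
  interpret HR: pair_prob_space H R by unfold_locales
  interpret PR: prob_space "PiM I (\<lambda>_. R)" by (intro prob_space_PiM R)
  have q: "0 \<le> q" "q \<le> 1" by (auto simp: q_def)
  define \<J> where "\<J> = {J. J \<subseteq> I \<and> card J = k}"
  have fin: "finite \<J>" unfolding \<J>_def using I by auto
  define T where "T x J = {s \<in> space (PiM I (\<lambda>_. R)). \<forall>i\<in>I. a (x i) (s i) \<longleftrightarrow> i \<in> J}" for x J
  have T: "T x J \<in> sets (PiM I (\<lambda>_. R))" if x: "x \<in> space (PiM I (\<lambda>_. H))" for x J
  proof -
    have [measurable]: "Measurable.pred (PiM I (\<lambda>_. R)) (\<lambda>s. a (x i) (s i))" if "i \<in> I" for i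
    proof -
      have [measurable]: "x i \<in> space H" using x that by (auto simp: space_PiM)
      note that[measurable]
      show ?thesis by measurable
    qed
    show ?thesis unfolding T_def using I
      by (intro sets.sets_Collect_finite_All predE) auto
  qed
  \<comment> \<open>Exchanging sum and integral needs measurability in the documents. It comes from
    joint measurability of the pattern event in documents and seeds, not from that of the single
    sections \<open>T x J\<close>.\<close>
  have meas: "(\<lambda>x. emeasure (PiM I (\<lambda>_. R)) (T x J)) \<in> borel_measurable (PiM I (\<lambda>_. H))" for J
  proof -
    have [measurable]: "Measurable.pred (PiM I (\<lambda>_. H) \<Otimes>\<^sub>M PiM I (\<lambda>_. R)) (\<lambda>y. a (fst y i) (snd y i))"
      if [measurable]: "i \<in> I" for i
      by measurable
    have [measurable]: "Measurable.pred (PiM I (\<lambda>_. H) \<Otimes>\<^sub>M PiM I (\<lambda>_. R))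
        (\<lambda>y. \<forall>i\<in>I. a (fst y i) (snd y i) \<longleftrightarrow> i \<in> J)"
      using I by (intro pred_intros_finite) auto
    have [measurable]: "Measurable.pred (PiM I (\<lambda>_. H) \<Otimes>\<^sub>M PiM I (\<lambda>_. R))
        (\<lambda>(x, s). \<forall>i\<in>I. a (x i) (s i) \<longleftrightarrow> i \<in> J)"
      by (simp add: case_prod_beta')
    show ?thesis unfolding T_def by measurable
  qed
  have "(\<integral>\<^sup>+ x. emeasure (PiM I (\<lambda>_. R))
            {s \<in> space (PiM I (\<lambda>_. R)). card {i\<in>I. a (x i) (s i)} = k} \<partial>PiM I (\<lambda>_. H))
      = (\<integral>\<^sup>+ x. (\<Sum>J\<in>\<J>. emeasure (PiM I (\<lambda>_. R)) (T x J)) \<partial>PiM I (\<lambda>_. H))"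
  proof (rule nn_integral_cong)
    fix x assume x: "x \<in> space (PiM I (\<lambda>_. H))"
    have "(\<Sum>J\<in>\<J>. emeasure (PiM I (\<lambda>_. R)) (T x J)) = emeasure (PiM I (\<lambda>_. R)) (\<Union>J\<in>\<J>. T x J)"
    proof (rule sum_emeasure)
      show "disjoint_family_on (T x) \<J>"
        by (auto simp: disjoint_family_on_def T_def \<J>_def)
    qed (use T x fin in auto)
    also have "(\<Union>J\<in>\<J>. T x J)
        = {s \<in> space (PiM I (\<lambda>_. R)). card {i\<in>I. a (x i) (s i)} = k}"
    proof (intro set_eqI iffI)
      fix s assume "s \<in> (\<Union>J\<in>\<J>. T x J)"
      then obtain J where J: "J \<subseteq> I" "card J = k" "s \<in> T x J" by (auto simp: \<J>_def)
      moreover have "{i\<in>I. a (x i) (s i)} = J" using J by (auto simp: T_def)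
      ultimately show "s \<in> {s \<in> space (PiM I (\<lambda>_. R)). card {i\<in>I. a (x i) (s i)} = k}"
        by (auto simp: T_def)
    next
      fix s assume "s \<in> {s \<in> space (PiM I (\<lambda>_. R)). card {i\<in>I. a (x i) (s i)} = k}"
      then have "{i\<in>I. a (x i) (s i)} \<in> \<J>" "s \<in> T x {i\<in>I. a (x i) (s i)}"
        by (auto simp: T_def \<J>_def)
      then show "s \<in> (\<Union>J\<in>\<J>. T x J)" by blast
    qed
    finally show "emeasure (PiM I (\<lambda>_. R))
            {s \<in> space (PiM I (\<lambda>_. R)). card {i\<in>I. a (x i) (s i)} = k}
        = (\<Sum>J\<in>\<J>. emeasure (PiM I (\<lambda>_. R)) (T x J))" ..
  qed
  also have "\<dots> = (\<Sum>J\<in>\<J>. \<integral>\<^sup>+ x. emeasure (PiM I (\<lambda>_. R)) (T x J) \<partial>PiM I (\<lambda>_. H))"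
    by (intro nn_integral_sum meas)
  also have "\<dots> = (\<Sum>J\<in>\<J>. ennreal (q ^ k * (1 - q) ^ (card I - k)))"
  proof (intro sum.cong refl)
    fix J assume "J \<in> \<J>"
    then have J: "J \<subseteq> I" "card J = k" by (auto simp: \<J>_def)
    then have "I \<inter> J = J" "card (I - J) = card I - k"
      using I by (auto simp: card_Diff_subset finite_subset)
    then show "(\<integral>\<^sup>+ x. emeasure (PiM I (\<lambda>_. R)) (T x J) \<partial>PiM I (\<lambda>_. H))
        = ennreal (q ^ k * (1 - q) ^ (card I - k))"
      unfolding T_def q_def using nn_integral_PiM_pattern[OF H R I a, of J] J by simp
  qed
  \<comment> \<open>\<open>n_subsets\<close> counts the index set \<open>\<J>\<close>; for
    \<open>k > card I\<close> the count and the binomial mass both vanish.\<close>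
  also have "\<dots> = ennreal (pmf (binomial_pmf (card I) q) k)"
    using q I n_subsets[OF I, of k]
    by (simp add: \<J>_def ennreal_of_nat_eq_real_of_nat mult.assoc flip: ennreal_mult)
  finally show ?thesis .
qed

section \<open>Joint laws of independent random elements\<close>

text \<open>A product of sigma-finite measures is determined by its values on measurable rectangles,
  and on a rectangle the claim is the product rule for the two preimages.\<close>

lemma (in prob_space) indep_elements_distr_pair:
  assumes "indep_elements M A Y B V"
  shows "distr M (A \<Otimes>\<^sub>M B) (\<lambda>w. (Y w, V w)) = distr M A Y \<Otimes>\<^sub>M distr M B V"
proof (rule pair_measure_eqI[symmetric])
  have [measurable]: "Y \<in> measurable M A" "V \<in> measurable M B"
    and ind: "indep_set {Y -` E \<inter> space M | E. E \<in> sets A} {V -` E \<inter> space M | E. E \<in> sets B}"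
    using assms by (auto simp: indep_elements_def)
  interpret Y: prob_space "distr M A Y" by (rule prob_space_distr) measurable
  interpret V: prob_space "distr M B V" by (rule prob_space_distr) measurable
  show "sigma_finite_measure (distr M A Y)" "sigma_finite_measure (distr M B V)" by unfold_locales
  show "sets (distr M A Y \<Otimes>\<^sub>M distr M B V) = sets (distr M (A \<Otimes>\<^sub>M B) (\<lambda>w. (Y w, V w)))"
    by (simp cong: sets_pair_measure_cong)
  fix E G assume "E \<in> sets (distr M A Y)" "G \<in> sets (distr M B V)"
  then have [measurable]: "E \<in> sets A" "G \<in> sets B" by auto
  have eq: "(\<lambda>w. (Y w, V w)) -` (E \<times> G) \<inter> space M = (Y -` E \<inter> space M) \<inter> (V -` G \<inter> space M)"
    by auto
  have "prob ((Y -` E \<inter> space M) \<inter> (V -` G \<inter> space M))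
      = prob (Y -` E \<inter> space M) * prob (V -` G \<inter> space M)"
    by (rule indep_setD[OF ind]) auto
  then show "emeasure (distr M A Y) E * emeasure (distr M B V) G
      = emeasure (distr M (A \<Otimes>\<^sub>M B) (\<lambda>w. (Y w, V w))) (E \<times> G)"
    by (simp add: emeasure_distr eq emeasure_eq_measure ennreal_mult)
qed

lemma (in prob_space) distr_iid_PiM:
  assumes "indep_vars (\<lambda>_. H) X I" "\<And>i. i \<in> I \<Longrightarrow> distr M H (X i) = H"
    and "I \<noteq> {}" "finite I"
  shows "distr M (PiM I (\<lambda>_. H)) (\<lambda>w. \<lambda>i\<in>I. X i w) = PiM I (\<lambda>_. H)"
proof -
  have "\<And>i. i \<in> I \<Longrightarrow> random_variable H (X i)"
    using assms(1) by (auto simp: indep_vars_def)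
  then have "distr M (PiM I (\<lambda>_. H)) (\<lambda>w. \<lambda>i\<in>I. X i w) = PiM I (\<lambda>i. distr M H (X i))"
    using indep_vars_iff_distr_eq_PiM'[of I X "\<lambda>_. H"] assms by simp
  also have "\<dots> = PiM I (\<lambda>_. H)" using assms(2) by (intro PiM_cong) auto
  finally show ?thesis .
qed

section \<open>The limit at zero alerts and the numerical bound\<close>

text \<open>For \<open>k = 0\<close> the lower tail is \<open>(1 - q) ^ N\<close>, which decreases
  in \<open>q\<close>. The admissible \<open>q\<close> therefore form a closed interval starting at
  0, whose right end solves \<open>(1 - q) ^ N = \<gamma>\<close>.\<close>

lemma clopper_pearson_upper_0:
  assumes "N \<ge> 1" "0 < \<gamma>" "\<gamma> < 1"
  shows "clopper_pearson_upper N 0 \<gamma> = 1 - \<gamma> powr (1 / real N)"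
proof -
  let ?c = "\<gamma> powr (1 / real N)"
  have c: "?c ^ N = \<gamma>" "0 < ?c" "?c \<le> 1"
    using assms by (auto simp: powr_powr simp flip: powr_realpow intro!: powr_le1)
  have "0 \<le> q \<and> q \<le> 1 \<and> \<gamma> \<le> measure_pmf.prob (binomial_pmf N q) {..0} \<longleftrightarrow> q \<in> {0..1 - ?c}" for q
  proof (cases "0 \<le> q \<and> q \<le> 1")
    case True
    then have "measure_pmf.prob (binomial_pmf N q) {..0} = (1 - q) ^ N"
      by (simp add: measure_pmf_single)
    moreover have "\<gamma> \<le> (1 - q) ^ N \<longleftrightarrow> q \<le> 1 - ?c"
      using power_mono_iff[of ?c "1 - q" N] c assms True by auto
    ultimately show ?thesis using True by simp
  next
    \<comment> \<open>Outside [0, 1] both sides fail: \<open>0 < ?c\<close> keeps the interval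
      inside [0, 1].\<close>
    case False
    then have "q \<notin> {0..1 - ?c}"
      using c(2) unfolding atLeastAtMost_iff by arith
    with False show ?thesis by blast
  qed
  then have "{q. 0 \<le> q \<and> q \<le> 1 \<and> \<gamma> \<le> measure_pmf.prob (binomial_pmf N q) {..0}} = {0..1 - ?c}"
    by blast
  \<comment> \<open>\<open>?c \<le> 1\<close> makes the interval nonempty, so its \<open>Sup\<close>
    is the right endpoint.\<close>
  then show ?thesis
    unfolding clopper_pearson_upper_def using c by simp
qed

lemma power_999_lower: "(0.999::real) ^ 2994 \<ge> 0.05"
proof -
  \<comment> \<open>The powers are rounded down to seven digits on the way to \<open>2994 = (15 * 15 + 5) * 13 + 4\<close>:
    the exact number has about 9000 digits.\<close>
  have step: "d \<le> b ^ (m * n + r)" if "c \<le> b ^ m" "d \<le> c ^ n * b ^ r" "0 \<le> c" "0 \<le> b"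
    for b c d :: real and m n r
    using that mult_right_mono[OF power_mono[of c "b ^ m" n], of "b ^ r"]
    by (simp add: power_add power_mult)
  have "0.9851045 \<le> (0.999::real) ^ 15"
    by (simp add: field_simps)
  then have "0.7944416 \<le> (0.999::real) ^ (15 * 15 + 5)"
    by (rule step) (simp_all add: field_simps)
  then have "0.05 \<le> (0.999::real) ^ ((15 * 15 + 5) * 13 + 4)"
    by (rule step) (simp_all add: field_simps)
  then show ?thesis by simp
qed

section \<open>Averaging over the random pipeline\<close>

text \<open>The value at \<open>p\<close> is the measure of the section at \<open>p\<close> of one
  jointly measurable set, and section measures are measurable in \<open>p\<close>. This lets the
  binomial mass serve as a version of the conditional probability.\<close>

lemma measurable_false_alert_prob:
  assumes "prob_space H" "prob_space R"
    and alert[measurable]: "(\<lambda>(p, x, s). alert p x s) \<in> measurable (P \<Otimes>\<^sub>M H \<Otimes>\<^sub>M R) (count_space UNIV)"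
  shows "false_alert_prob alert H R \<in> borel_measurable P"
proof -
  interpret H: prob_space H by fact
  interpret R: prob_space R by fact
  interpret HR: pair_prob_space H R by unfold_locales
  let ?Q = "{y \<in> space (P \<Otimes>\<^sub>M H \<Otimes>\<^sub>M R). case y of (p, x, s) \<Rightarrow> alert p x s}"
  have "?Q \<in> sets (P \<Otimes>\<^sub>M H \<Otimes>\<^sub>M R)" by measurable
  then have [measurable]: "(\<lambda>p. emeasure (H \<Otimes>\<^sub>M R) (Pair p -` ?Q)) \<in> borel_measurable P"
    by (rule HR.P.measurable_emeasure_Pair)
  have "(\<lambda>p. enn2real (emeasure (H \<Otimes>\<^sub>M R) (Pair p -` ?Q))) \<in> borel_measurable P"
    by measurable
  moreover have "false_alert_prob alert H R p = enn2real (emeasure (H \<Otimes>\<^sub>M R) (Pair p -` ?Q))"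
    if "p \<in> space P" for p
    unfolding false_alert_prob_def measure_def using that
    by (intro arg_cong[where f = enn2real] arg_cong2[where f = emeasure])
      (auto simp: space_pair_measure)
  ultimately show ?thesis
    by (simp cong: measurable_cong)
qed

lemma false_alert_prob_bounds:
  assumes "prob_space H" "prob_space R"
  shows "0 \<le> false_alert_prob alert H R p" "false_alert_prob alert H R p \<le> 1"
proof -
  interpret H: prob_space H by fact
  interpret R: prob_space R by fact
  interpret HR: pair_prob_space H R by unfold_locales
  show "0 \<le> false_alert_prob alert H R p" "false_alert_prob alert H R p \<le> 1"
    by (auto simp: false_alert_prob_def)
qed

text \<open>Here \<open>X\<close> and \<open>S\<close> are whole vectors of documents and seeds, and
  independence enters through \<open>law\<close>. Since the data form a separate factor, freezing
  them at \<open>z\<close> fixes the pipeline, and the count lemma evaluates the inner integrals.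
  The set \<open>B\<close> is carried along because the identity for all \<open>B\<close> is what
  characterizes a conditional probability given the pipeline.\<close>

lemma emeasure_false_alert_count:
  fixes N k :: nat and H :: "'x measure" and R :: "'s measure"
  defines "PH \<equiv> PiM {..<N} (\<lambda>_. H)" and "PR \<equiv> PiM {..<N} (\<lambda>_. R)"
  assumes H: "prob_space H" and R: "prob_space R" and M: "prob_space M"
    and Z[measurable]: "Z \<in> measurable M D"
    and X[measurable]: "X \<in> measurable M PH"
    and S[measurable]: "S \<in> measurable M PR"
    and law: "distr M ((D \<Otimes>\<^sub>M PH) \<Otimes>\<^sub>M PR) (\<lambda>w. ((Z w, X w), S w)) = (distr M D Z \<Otimes>\<^sub>M PH) \<Otimes>\<^sub>M PR"
    and fit[measurable]: "fit \<in> measurable D P"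
    and alert: "(\<lambda>(p, x, s). alert p x s) \<in> measurable (P \<Otimes>\<^sub>M H \<Otimes>\<^sub>M R) (count_space UNIV)"
    and B[measurable]: "B \<in> sets P"
  defines "E \<equiv> {w \<in> space M. fit (Z w) \<in> B \<and> card {i \<in> {..<N}. alert (fit (Z w)) (X w i) (S w i)} = k}"
  shows "E \<in> sets M"
    and "emeasure M E = (\<integral>\<^sup>+ w. indicator B (fit (Z w)) *
           ennreal (pmf (binomial_pmf N (false_alert_prob alert H R (fit (Z w)))) k) \<partial>M)"
proof -
  interpret M: prob_space M by fact
  interpret H: prob_space H by fact
  interpret R: prob_space R by fact
  interpret PH: prob_space PH unfolding PH_def by (intro prob_space_PiM H)
  interpret PR: prob_space PR unfolding PR_def by (intro prob_space_PiM R)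
  interpret Z: prob_space "distr M D Z" by (intro M.prob_space_distr Z)
  let ?L = "(D \<Otimes>\<^sub>M PH) \<Otimes>\<^sub>M PR"
  define T where "T = {y \<in> space ?L. fit (fst (fst y)) \<in> B \<and>
    card {i. i < N \<and> alert (fit (fst (fst y))) (snd (fst y) i) (snd y i)} = k}"
  have comp: "(\<lambda>x. x i) \<in> measurable PH H" "(\<lambda>x. x i) \<in> measurable PR R" if "i < N" for i
    unfolding PH_def PR_def using that by (auto intro!: measurable_component_singleton)
  have alert_i: "Measurable.pred ?L (\<lambda>y. alert (fit (fst (fst y))) (snd (fst y) i) (snd y i))"
    if "i < N" for i
  proof -
    have "(\<lambda>y. (fit (fst (fst y)), snd (fst y) i, snd y i)) \<in> measurable ?L (P \<Otimes>\<^sub>M H \<Otimes>\<^sub>M R)"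
      by (intro measurable_Pair measurable_compose[OF _ fit]
          measurable_compose[OF _ comp(1)[OF that]] measurable_compose[OF _ comp(2)[OF that]])
        measurable
    from measurable_compose[OF this alert] show ?thesis by simp
  qed
  \<comment> \<open>\<open>measurable_card\<close> asks about membership of every natural number.
    Coordinates are measurable only below \<open>N\<close>; from \<open>N\<close> on the predicate
    is constantly false.\<close>
  have alert_i': "Measurable.pred ?L
      (\<lambda>y. i < N \<and> alert (fit (fst (fst y))) (snd (fst y) i) (snd y i))" for i
    using alert_i[of i] by (cases "i < N") auto
  have count: "(\<lambda>y. card {i. i < N \<and> alert (fit (fst (fst y))) (snd (fst y) i) (snd y i)})
      \<in> measurable ?L (count_space UNIV)"
    by (rule measurable_card, subst mem_Collect_eq, rule predE[OF alert_i'])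
  have "(\<lambda>y. fit (fst (fst y))) \<in> measurable ?L P" by measurable
  from sets.Int[OF measurable_sets[OF this B] measurable_sets[OF count, of "{k}"]]
  have T[measurable]: "T \<in> sets ?L"
    by (simp add: T_def vimage_def Int_def conj_left_commute conj_commute cong: conj_cong)
  have E_eq: "E = (\<lambda>w. ((Z w, X w), S w)) -` T \<inter> space M"
    using measurable_space[OF Z] measurable_space[OF X] measurable_space[OF S]
    by (auto simp: E_def T_def space_pair_measure)
  show "E \<in> sets M" unfolding E_eq by measurable
  have T': "T \<in> sets ((distr M D Z \<Otimes>\<^sub>M PH) \<Otimes>\<^sub>M PR)"
    using T by (simp cong: sets_pair_measure_cong)
  note meas_q[measurable] = measurable_false_alert_prob[OF H R alert]
  note q = false_alert_prob_bounds[OF H R, of alert]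
  have "emeasure M E = emeasure (distr M ?L (\<lambda>w. ((Z w, X w), S w))) T"
    unfolding E_eq by (rule emeasure_distr[symmetric]) measurable
  also have "\<dots> = (\<integral>\<^sup>+ y. emeasure PR (Pair y -` T) \<partial>(distr M D Z \<Otimes>\<^sub>M PH))"
    unfolding law by (rule PR.emeasure_pair_measure_alt[OF T'])
  \<comment> \<open>The data are integrated outermost, so that the pipeline is constant in the
    integrals over documents and seeds.\<close>
  also have "\<dots> = (\<integral>\<^sup>+ z. \<integral>\<^sup>+ x. emeasure PR (Pair (z, x) -` T) \<partial>PH \<partial>distr M D Z)"
    by (rule PH.nn_integral_fst[symmetric]) (rule PR.measurable_emeasure_Pair[OF T'])
  also have "\<dots> = (\<integral>\<^sup>+ z. indicator B (fit z) *
      ennreal (pmf (binomial_pmf N (false_alert_prob alert H R (fit z))) k) \<partial>distr M D Z)"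
  proof (rule nn_integral_cong)
    fix z assume "z \<in> space (distr M D Z)"
    then have z: "z \<in> space D" by simp
    then have p: "fit z \<in> space P" by (rule measurable_space[OF fit])
    have pred: "Measurable.pred (H \<Otimes>\<^sub>M R) (\<lambda>(x, s). alert (fit z) x s)"
      using measurable_compose[OF measurable_Pair1'[OF p] alert] by simp
    show "(\<integral>\<^sup>+ x. emeasure PR (Pair (z, x) -` T) \<partial>PH) = indicator B (fit z) *
      ennreal (pmf (binomial_pmf N (false_alert_prob alert H R (fit z))) k)"
    proof (cases "fit z \<in> B")
      case True
      then have "Pair (z, x) -` T = {s \<in> space PR. card {i \<in> {..<N}. alert (fit z) (x i) (s i)} = k}"
        if "x \<in> space PH" for x
        using that z by (auto simp: T_def space_pair_measure)
      then have "(\<integral>\<^sup>+ x. emeasure PR (Pair (z, x) -` T) \<partial>PH) = (\<integral>\<^sup>+ x. emeasure PR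
          {s \<in> space PR. card {i \<in> {..<N}. alert (fit z) (x i) (s i)} = k} \<partial>PH)"
        by (intro nn_integral_cong) simp
      then show ?thesis
        using True nn_integral_PiM_count[OF H R _ pred, of "{..<N}" k]
        by (simp add: PH_def PR_def false_alert_prob_def)
    next
      case False
      then have "Pair (z, x) -` T = {}" for x by (auto simp: T_def)
      then show ?thesis using False by simp
    qed
  qed
  also have "\<dots> = (\<integral>\<^sup>+ w. indicator B (fit (Z w)) *
      ennreal (pmf (binomial_pmf N (false_alert_prob alert H R (fit (Z w)))) k) \<partial>M)"
    using q by (intro nn_integral_distr) simp_all
  finally show "emeasure M E = (\<integral>\<^sup>+ w. indicator B (fit (Z w)) *
           ennreal (pmf (binomial_pmf N (false_alert_prob alert H R (fit (Z w)))) k) \<partial>M)" .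
qed

section \<open>The conditional law given the pipeline, and the audit size\<close>

text \<open>The sets of the sigma-algebra generated by \<open>Y\<close> are exactly the preimages of
  sets \<open>B\<close> of \<open>P\<close>, so \<open>eq\<close> tests \<open>g (Y w)\<close>
  against all of them. As \<open>g (Y w)\<close> is also measurable for that sigma-algebra, almost
  sure uniqueness of conditional expectations applies.\<close>

lemma (in prob_space) cond_prob_given_charact:
  assumes Y[measurable]: "Y \<in> measurable M P" and E[measurable]: "E \<in> sets M"
    and g[measurable]: "g \<in> borel_measurable P"
    and g_bounds: "\<And>p. 0 \<le> g p" "\<And>p. g p \<le> 1"
    and eq: "\<And>B. B \<in> sets P \<Longrightarrow>
      emeasure M {w \<in> space M. Y w \<in> B \<and> w \<in> E} = (\<integral>\<^sup>+ w. indicator B (Y w) * ennreal (g (Y w)) \<partial>M)"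
  shows "AE w in M. cond_prob_given M P Y E w = g (Y w)"
proof -
  let ?G = "vimage_algebra (space M) Y P"
  have YG: "Y \<in> space M \<rightarrow> space P" using measurable_space[OF Y] by auto
  have sub: "subalgebra M ?G"
    using YG by (auto simp: subalgebra_def sets_vimage_algebra2)
  interpret finite_measure_subalgebra M ?G by unfold_locales (rule sub)
  have int: "integrable M (\<lambda>w. g (Y w))"
    by (rule integrable_const_bound[where B = 1]) (use g_bounds in auto)
  have "AE w in M. real_cond_exp M ?G (indicator E) w = g (Y w)"
  proof (rule real_cond_exp_charact[OF _ _ int])
    show "integrable M (indicator E :: _ \<Rightarrow> real)"
      using E by (intro integrable_real_indicator) (auto simp: emeasure_eq_measure)
    show "(\<lambda>w. g (Y w)) \<in> borel_measurable ?G"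
      using measurable_vimage_algebra1[OF YG] g by (rule measurable_compose)
    fix A assume "A \<in> sets ?G"
    then obtain B where B[measurable]: "B \<in> sets P" and A: "A = Y -` B \<inter> space M"
      using YG by (auto simp: sets_vimage_algebra2)
    have A_meas[measurable]: "A \<in> sets M" unfolding A by measurable
    have "(\<integral>\<^sup>+ w. ennreal (indicator A w * g (Y w)) \<partial>M)
        = ennreal (\<integral>w. indicator A w * g (Y w) \<partial>M)"
      using integrable_real_mult_indicator[OF A_meas int] g_bounds
      by (intro nn_integral_eq_integral) (auto simp: mult.commute)
    moreover have "(\<integral>\<^sup>+ w. ennreal (indicator A w * g (Y w)) \<partial>M)
        = (\<integral>\<^sup>+ w. indicator B (Y w) * ennreal (g (Y w)) \<partial>M)"
      by (intro nn_integral_cong) (auto simp: A indicator_def)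
    moreover have "{w \<in> space M. Y w \<in> B \<and> w \<in> E} = A \<inter> E"
      using sets.sets_into_space[OF E] by (auto simp: A)
    ultimately have "ennreal (prob (A \<inter> E)) = ennreal (\<integral>w. indicator A w * g (Y w) \<partial>M)"
      using eq[OF B] by (simp add: emeasure_eq_measure)
    \<comment> \<open>Both sides are nonnegative, so \<open>ennreal\<close> can be cancelled;
      \<open>real_cond_exp_charact\<close> needs the identity for real integrals.\<close>
    then have "prob (A \<inter> E) = (\<integral>w. indicator A w * g (Y w) \<partial>M)"
      using g_bounds by (subst (asm) ennreal_inj) (auto intro!: integral_nonneg)
    moreover have "(\<integral>w. indicator A w * indicator E w \<partial>M) = prob (A \<inter> E)"
      by (simp flip: indicator_inter_arith)
    ultimately show "(LINT w:A|M. indicator E w) = (LINT w:A|M. g (Y w))"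
      by (simp add: set_lebesgue_integral_def)
  qed
  then show ?thesis by (simp add: cond_prob_given_def)
qed

theorem proposition6p5:
  fixes M :: "'w measure" and D :: "'d measure" and P :: "'p measure"
    and H :: "'x measure" and R :: "'s measure"
    and Z :: "'w \<Rightarrow> 'd" and fit :: "'d \<Rightarrow> 'p"
    and alert :: "'p \<Rightarrow> 'x \<Rightarrow> 's \<Rightarrow> bool"
    and X :: "nat \<Rightarrow> 'w \<Rightarrow> 'x" and S :: "nat \<Rightarrow> 'w \<Rightarrow> 's"
    and N0 :: nat and \<gamma> :: real
  defines "F \<equiv> (\<lambda>w. fit (Z w))"
    and "K \<equiv> false_alert_count alert N0 (\<lambda>w. fit (Z w)) X S"
  assumes prob: "prob_space M"
    and N0: "N0 \<ge> 1"
    and fit: "fit \<in> measurable D P"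
    and alert: "(\<lambda>(p, x, s). alert p x s) \<in> measurable (P \<Otimes>\<^sub>M H \<Otimes>\<^sub>M R) (count_space UNIV)"
    and docs_iid: "prob_space.indep_vars M (\<lambda>_. H) X {..<N0}"
      "\<And>i. i < N0 \<Longrightarrow> distr M H (X i) = H"
    and docs_indep: "indep_elements M
        D Z (PiM {..<N0} (\<lambda>_. H)) (\<lambda>w. \<lambda>i\<in>{..<N0}. X i w)"
    and seeds_iid: "prob_space.indep_vars M (\<lambda>_. R) S {..<N0}"
      "\<And>i. i < N0 \<Longrightarrow> distr M R (S i) = R"
    and seeds_indep: "indep_elements M
        (D \<Otimes>\<^sub>M PiM {..<N0} (\<lambda>_. H)) (\<lambda>w. (Z w, \<lambda>i\<in>{..<N0}. X i w))
        (PiM {..<N0} (\<lambda>_. R)) (\<lambda>w. \<lambda>i\<in>{..<N0}. S i w)"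
    and \<gamma>: "0 < \<gamma>" "\<gamma> < 1"
  shows "(AE w in M. \<forall>k. cond_prob_given M P F {v \<in> space M. K v = k} w
            = pmf (binomial_pmf N0 (false_alert_prob alert H R (F w))) k)
    \<and> clopper_pearson_upper N0 0 \<gamma> = 1 - \<gamma> powr (1 / real N0)
    \<and> (clopper_pearson_upper N0 0 0.05 < 0.001 \<longrightarrow> N0 \<ge> 2995)"
proof (intro conjI impI)
  interpret prob_space M by fact
  let ?PH = "PiM {..<N0} (\<lambda>_. H)" and ?PR = "PiM {..<N0} (\<lambda>_. R)"
  let ?X = "\<lambda>w. \<lambda>i\<in>{..<N0}. X i w" and ?S = "\<lambda>w. \<lambda>i\<in>{..<N0}. S i w"
  have ne: "{..<N0} \<noteq> {}" using N0 by (simp add: lessThan_empty_iff)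
  have meas: "X 0 \<in> measurable M H" "S 0 \<in> measurable M R"
    using docs_iid(1) seeds_iid(1) N0 by (auto simp: indep_vars_def)
  \<comment> \<open>\<open>H\<close> and \<open>R\<close> are the laws of \<open>X 0\<close> and
    \<open>S 0\<close>, and index 0 is available because \<open>N0 \<ge> 1\<close>.\<close>
  have H: "prob_space H" and R: "prob_space R"
    using prob_space_distr[OF meas(1)] prob_space_distr[OF meas(2)] docs_iid(2)[of 0] seeds_iid(2)[of 0] N0
    by auto
  have Z[measurable]: "Z \<in> measurable M D" and X: "?X \<in> measurable M ?PH" and S: "?S \<in> measurable M ?PR"
    using docs_indep seeds_indep by (auto simp: indep_elements_def)
  have "distr M ?PH ?X = ?PH" "distr M ?PR ?S = ?PR"
    using distr_iid_PiM[OF docs_iid(1) _ ne] distr_iid_PiM[OF seeds_iid(1) _ ne] docs_iid(2) seeds_iid(2)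
    by auto
  \<comment> \<open>The product is built in two stages: the documents are independent of the data,
    then the seeds are independent of data and documents jointly.\<close>
  then have law: "distr M ((D \<Otimes>\<^sub>M ?PH) \<Otimes>\<^sub>M ?PR) (\<lambda>w. ((Z w, ?X w), ?S w))
      = (distr M D Z \<Otimes>\<^sub>M ?PH) \<Otimes>\<^sub>M ?PR"
    using indep_elements_distr_pair[OF docs_indep] indep_elements_distr_pair[OF seeds_indep] by simp
  have F: "F \<in> measurable M P" unfolding F_def using Z fit by (rule measurable_compose)
  note count = emeasure_false_alert_count[OF H R prob Z X S law fit alert]
  let ?g = "\<lambda>k p. pmf (binomial_pmf N0 (false_alert_prob alert H R p)) k"
  have K: "card {i \<in> {..<N0}. alert (fit (Z w)) (?X w i) (?S w i)} = K w" for w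
    unfolding K_def false_alert_count_def by (rule arg_cong[where f = card]) auto
  have "AE w in M. cond_prob_given M P F {v \<in> space M. K v = k} w = ?g k (F w)" for k
  proof (rule cond_prob_given_charact[OF F])
    \<comment> \<open>Measurability of the count event is the case \<open>B = space P\<close> of the
      averaged statement.\<close>
    have "{v \<in> space M. K v = k} = {w \<in> space M. fit (Z w) \<in> space P \<and> K w = k}"
      using measurable_space[OF F] by (auto simp: F_def)
    then show "{v \<in> space M. K v = k} \<in> sets M"
      using count(1)[of "space P" k] unfolding K by simp
    show "?g k \<in> borel_measurable P"
      using measurable_false_alert_prob[OF H R alert] false_alert_prob_bounds[OF H R, of alert] by simp
    show "0 \<le> ?g k p" "?g k p \<le> 1" for p by (auto simp: pmf_le_1)
    fix B assume "B \<in> sets P"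
    from count(2)[OF this, of k] show "emeasure M {w \<in> space M. F w \<in> B \<and> w \<in> {v \<in> space M. K v = k}}
        = (\<integral>\<^sup>+ w. indicator B (F w) * ennreal (?g k (F w)) \<partial>M)"
      unfolding K F_def by (simp cong: conj_cong)
  qed
  \<comment> \<open>The exceptional null set depends on \<open>k\<close>; countably many of them
    combine into one, so the whole conditional law is binomial outside a single null set.\<close>
  then show "AE w in M. \<forall>k. cond_prob_given M P F {v \<in> space M. K v = k} w = ?g k (F w)"
    by (simp add: AE_all_countable)
  show "clopper_pearson_upper N0 0 \<gamma> = 1 - \<gamma> powr (1 / real N0)"
    using clopper_pearson_upper_0[OF N0 \<gamma>] .
  assume "clopper_pearson_upper N0 0 0.05 < 0.001"
  then have "(0.999::real) < 0.05 powr (1 / real N0)"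
    using clopper_pearson_upper_0[OF N0, of "0.05"] by simp
  \<comment> \<open>Raising to the positive power \<open>N0\<close> removes the root and keeps the
    inequality strict.\<close>
  then have "(0.999::real) ^ N0 < (0.05 powr (1 / real N0)) ^ N0"
    using N0 by (intro power_strict_mono) auto
  also have "\<dots> = 0.05"
    using N0 by (simp add: powr_powr flip: powr_realpow)
  finally have less: "(0.999::real) ^ N0 < 0.05" .
  show "2995 \<le> N0"
  \<comment> \<open>Powers of 0.999 decrease, so the bound at exponent 2994 rules out every smaller
    \<open>N0\<close> as well.\<close>
  proof (rule ccontr)
    assume "\<not> 2995 \<le> N0"
    then have "(0.999::real) ^ 2994 \<le> 0.999 ^ N0"
      by (intro power_decreasing) auto
    with less power_999_lower show False by linarith
  qed
qed

end
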